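(* Let $D$ be the formal derivative associated with the context-free grammar $G=\{x\rightarrow xy,\; y\rightarrow xy\}$, so that $D(x)=xy$ and $D(y)=xy$. Then for every integer $n\geq 1$, $$(xD)^n(x)=\sum_{k=0}^{n-1}\left\langle\!\!\left\langle {n \atop k} \right\rangle\!\!\right\rangle x^{2n-k}y^{k+1},$$ where $\left\langle\!\left\langle {n \atop k} \right\rangle\!\right\rangle$ denotes the second-order Eulerian number.
   Context: Letters $x,y$ are independent commuting indeterminates. A context-free grammar $G$ over $\{x,y\}$ is a set of substitution rules replacing each letter by a formal function of the letters. The formal derivative $D$ with respect to $G$ is the linear operator sending each letter to the right-hand side of its rule and satisfying $D(u+v)=D(u)+D(v)$, $D(uv)=D(u)v+uD(v)$ and $D(f(u))=\frac{\partial f(u)}{\partial u}D(u)$ for analytic $f$ (in particular $D$ kills constants; on polynomials in $x,y$ it is the derivation determined by the rules). The powers of $xD$ are defined by $(xD)^0(x)=x$ and $(xD)^{n+1}(x)=x\,D\big((xD)^n(x)\big)$ for $n\ge 0$. A Stirling permutation of order $n$ is a permutation $\sigma_1\sigma_2\cdots\sigma_{2n}$ of the multiset $\{1,1,2,2,\ldots,n,n\}$ such that for each $i$, $1\leq i\leq n$, the elements lying between the two occurrences of $i$ are greater than $i$. The second-order Eulerian number $\left\langle\!\left\langle {n \atop k} \right\rangle\!\right\rangle$ is the number of Stirling permutations of order $n$ with exactly $k$ ascents (indices $1\le i\le 2n-1$ with $\sigma_i<\sigma_{i+1}$). It is well known that these numbers satisfy $$\left\langle\!\!\left\langle {n+1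 \atop k} \right\rangle\!\!\right\rangle=(2n-k+1)\left\langle\!\!\left\langle {n \atop k-1} \right\rangle\!\!\right\rangle+(k+1)\left\langle\!\!\left\langle {n \atop k} \right\rangle\!\!\right\rangle \quad (n\ge 1),$$ with initial condition $\left\langle\!\left\langle {1 \atop 0} \right\rangle\!\right\rangle=1$ and boundary conditions $\left\langle\!\left\langle {n \atop k} \right\rangle\!\right\rangle=0$ for $n\leq k$ or $k<0$. *)

theory Defs
  imports "HOL-Computational_Algebra.Polynomial" "HOL-Combinatorics.Multiset_Permutations"
begin

text \<open>
  Polynomials in the commuting indeterminates \<open>x\<close>, \<open>y\<close> are rendered as \<open>K[x][y]\<close>, i.e. as
  \<^typ>\<open>'a poly poly\<close>: the inner variable is \<open>x\<close>, the outer one is \<open>y\<close>.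
\<close>

datatype letter = X | Y

primrec indet :: "letter \<Rightarrow> 'a::comm_semiring_1 poly poly" where
  "indet X = [:[:0, 1:]:]"
| "indet Y = [:0, 1:]"

type_synonym 'a grammar = "letter \<Rightarrow> 'a poly poly"

text \<open>
  The rule \<open>D (f u) = f' u * D u\<close> is not part of the definition; on polynomials it follows
  (lemma \<open>formal_derivative_chain\<close> below).
\<close>

definition formal_derivative ::
    "'a::field_char_0 grammar \<Rightarrow> ('a poly poly \<Rightarrow> 'a poly poly) \<Rightarrow> bool" where
  "formal_derivative G D \<longleftrightarrow>
     (\<forall>v. D (indet v) = G v) \<and>
     (\<forall>c u. D (smult [:c:] u) = smult [:c:] (D u)) \<and>
     (\<forall>u v. D (u + v) = D u + D v) \<and>
     (\<forall>u v. D (u * v) = D u * v + u * D v)"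

definition grammar_xy :: "'a::field_char_0 grammar" where
  "grammar_xy = (\<lambda>v. case v of X \<Rightarrow> indet X * indet Y | Y \<Rightarrow> indet X * indet Y)"

definition stirling_permutations :: "nat \<Rightarrow> nat list set" where
  "stirling_permutations n =
     {s \<in> permutations_of_multiset (mset_set {1..n} + mset_set {1..n}).
        \<forall>a b c. a < b \<longrightarrow> b < c \<longrightarrow> c < length s \<longrightarrow> s ! a = s ! c \<longrightarrow> s ! b > s ! a}"

definition ascents :: "nat list \<Rightarrow> nat set" where
  "ascents s = {i. Suc i < length s \<and> s ! i < s ! Suc i}"

definition eulerian2 :: "nat \<Rightarrow> nat \<Rightarrow> nat" where
  "eulerian2 n k = card {s \<in> stirling_permutations n. card (ascents s) = k}"

text \<open>The formal derivative of a grammar exists and is unique.\<close>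

lemma map_poly_pderiv_mult:
  fixes p q :: "'a::field_char_0 poly poly"
  shows "map_poly pderiv (p * q) = map_poly pderiv p * q + p * map_poly pderiv q"
proof -
  have "coeff (map_poly pderiv (p * q)) n
      = coeff (map_poly pderiv p * q + p * map_poly pderiv q) n" for n
  proof -
    have s: "pderiv (sum f A) = (\<Sum>i\<in>A. pderiv (f i))" for f :: "nat \<Rightarrow> 'a poly" and A
      by (induction A rule: infinite_finite_induct) (auto simp: pderiv_add)
    show ?thesis
      by (simp add: coeff_map_poly coeff_mult s pderiv_mult sum.distrib add.commute
          mult.commute[of "coeff q _" "pderiv _"])
  qed
  then show ?thesis by (rule poly_eqI)
qed

lemma formal_derivative_ex:
  fixes G :: "'a::field_char_0 grammar"
  shows "formal_derivative G (\<lambda>p. map_poly pderiv p * G X + pderiv p * G Y)"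
proof -
  have add: "map_poly pderiv (u + v) = map_poly pderiv u + map_poly pderiv v"
    for u v :: "'a poly poly"
    by (rule poly_eqI) (simp add: coeff_map_poly pderiv_add)
  have smult: "map_poly pderiv (smult [:c:] u) = smult [:c:] (map_poly pderiv u)"
    for c and u :: "'a poly poly"
    by (rule poly_eqI) (simp add: coeff_map_poly pderiv_smult)
  have "map_poly pderiv (1 :: 'a poly poly) = 0"
    by (rule poly_eqI) (simp add: coeff_map_poly)
  then have "map_poly pderiv (indet v) * G X + pderiv (indet v) * G Y = G v" for v
    by (cases v) (simp_all add: map_poly_pCons pderiv_pCons flip: one_pCons)
  then show ?thesis
    by (simp add: formal_derivative_def add smult map_poly_pderiv_mult pderiv_mult pderiv_add
        pderiv_smult smult_add_right algebra_simps)
qed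

lemma formal_derivative_const:
  assumes "formal_derivative G D"
  shows "D [:[:c:]:] = 0"
proof -
  have "D (1 * 1) = D 1 * 1 + 1 * D 1"
    using assms unfolding formal_derivative_def by blast
  then have "D 1 = 0" by simp
  moreover have "D (smult [:c:] 1) = smult [:c:] (D 1)"
    using assms unfolding formal_derivative_def by blast
  ultimately show ?thesis by simp
qed

lemma formal_derivative_unique:
  assumes D: "formal_derivative G D" and E: "formal_derivative G E"
  shows "D = E"
proof -
  have add: "D (u + v) = D u + D v" "E (u + v) = E u + E v" for u v
    using D E unfolding formal_derivative_def by blast+
  have mult: "D (u * v) = D u * v + u * D v" "E (u * v) = E u * v + u * E v" for u v
    using D E unfolding formal_derivative_def by blast+
  have letter: "D (indet v) = E (indet v)" for v
    using D E by (simp add: formal_derivative_def)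
  have inner: "D [:a:] = E [:a:]" for a
  proof (induction a)
    case 0
    show ?case
      using formal_derivative_const[OF D, of 0] formal_derivative_const[OF E, of 0] by simp
  next
    case (pCons c b)
    have "[:pCons c b:] = [:[:c:]:] + indet X * [:b:]" by simp
    then show ?case
      using pCons letter[of X] formal_derivative_const[OF D] formal_derivative_const[OF E]
      by (simp only: add mult)
  qed
  have "D p = E p" for p
  proof (induction p)
    case 0
    show ?case using inner[of 0] by simp
  next
    case (pCons a q)
    have "pCons a q = [:a:] + indet Y * q" by simp
    then show ?case using pCons letter[of Y] inner by (simp only: add mult)
  qed
  then show ?thesis by blast
qed

lemma formal_derivative_chain:
  assumes D: "formal_derivative G D"
  shows "D (poly (map_poly (\<lambda>c. [:[:c:]:]) f) u)
       = poly (map_poly (\<lambda>c. [:[:c:]:]) (pderiv f)) u * D u"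
proof -
  have add: "D (u + v) = D u + D v" and mult: "D (u * v) = D u * v + u * D v" for u v
    using D unfolding formal_derivative_def by blast+
  have map_add: "map_poly (\<lambda>c. [:[:c:]:]) (p + q)
      = map_poly (\<lambda>c. [:[:c:]:]) p + map_poly (\<lambda>c. [:[:c:]:]) q" for p q :: "'a poly"
    by (rule poly_eqI) (simp add: coeff_map_poly)
  show ?thesis
  proof (induction f)
    case 0
    show ?case using formal_derivative_const[OF D, of 0] by simp
  next
    case (pCons c f)
    then show ?case
      by (simp add: map_poly_pCons add mult formal_derivative_const[OF D] pderiv_pCons map_add
          algebra_simps)
  qed
qed

end

theory Submission
  imports Defs "HOL-Library.Sublist"
begin

text \<open>
  Every Stirling permutation of order \<open>n + 1\<close> arises exactly once by inserting the block
  \<open>n + 1, n + 1\<close> into one of the \<open>2n + 1\<close> gaps of a Stirling permutation \<open>s\<close> of order \<open>n\<close>.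
  If \<open>s\<close> has \<open>k\<close> ascents, the insertion preserves this number for the \<open>k + 1\<close> gaps that are
  initial or at an ascent, and raises it by one for the other \<open>2n - k\<close> gaps. Likewise \<open>x D\<close> sends
  the weight \<open>x^(2n-k) y^(k+1)\<close> of \<open>s\<close> to the sum of \<open>k + 1\<close> weights with \<open>k\<close> ascents and
  \<open>2n - k\<close> weights with \<open>k + 1\<close> ascents. For \<open>n = 0\<close> the weight sum is \<open>y\<close>, not \<open>x\<close>, but
  \<open>D x = D y\<close>, so the two agree from \<open>n = 1\<close> on.
\<close>

section \<open>Stirling permutations as lists avoiding three-letter subsequences\<close>

lemma subseq_pair_nth:
  assumes "b < c" "c < length s"
  shows "subseq [s ! b, s ! c] s"
  using assms
proof (induction s arbitrary: b c)
  case (Cons x s)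
  then show ?case
    by (cases b; cases c) (auto simp: subseq_singleton_left)
qed simp

lemma subseq_triple_nth:
  assumes "a < b" "b < c" "c < length s"
  shows "subseq [s ! a, s ! b, s ! c] s"
  using assms
proof (induction s arbitrary: a b c)
  case (Cons x s)
  obtain b' c' where bc: "b = Suc b'" "c = Suc c'"
    using Cons.prems by (metis less_nat_zero_code not0_implies_Suc)
  show ?case
  proof (cases a)
    case 0
    then show ?thesis using bc Cons.prems subseq_pair_nth[of b' c' s] by simp
  next
    case (Suc a')
    then have "subseq [s ! a', s ! b', s ! c'] s" using bc Cons.prems by (intro Cons.IH) simp_all
    then show ?thesis unfolding bc Suc nth_Cons_Suc by (rule list_emb_Cons)
  qed
qed simp

lemma subseq_triple_iff_nth:
  "subseq [i, j, k] s \<longleftrightarrow>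
    (\<exists>a b c. a < b \<and> b < c \<and> c < length s \<and> s ! a = i \<and> s ! b = j \<and> s ! c = k)"
proof
  assume "subseq [i, j, k] s"
  then obtain u v w z where s: "s = u @ i # v @ j # w @ k # z"
    by (blast dest: list_emb_ConsD)
  let ?a = "length u"
  let ?b = "?a + 1 + length v"
  let ?c = "?b + 1 + length w"
  have "?a < ?b \<and> ?b < ?c \<and> ?c < length s \<and> s ! ?a = i \<and> s ! ?b = j \<and> s ! ?c = k"
    by (simp add: s nth_append)
  then show "\<exists>a b c. a < b \<and> b < c \<and> c < length s \<and> s ! a = i \<and> s ! b = j \<and> s ! c = k"
    by blast
qed (use subseq_triple_nth in blast)

text \<open>In terms of subsequences the defining condition passes to filtered and shortened lists,
  so inserting or deleting a block needs no index shifts.\<close>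

lemma stirling_permutations_iff:
  "s \<in> stirling_permutations n \<longleftrightarrow>
     mset s = mset_set {1..n} + mset_set {1..n} \<and> (\<forall>i j. subseq [i, j, i] s \<longrightarrow> i < j)"
proof -
  have "(\<forall>i j. subseq [i, j, i] s \<longrightarrow> i < j) \<longleftrightarrow>
      (\<forall>a b c. a < b \<longrightarrow> b < c \<longrightarrow> c < length s \<longrightarrow> s ! a = s ! c \<longrightarrow> s ! b > s ! a)"
    unfolding subseq_triple_iff_nth by metis
  then show ?thesis
    unfolding stirling_permutations_def permutations_of_multiset_def by blast
qed

lemma finite_stirling_permutations: "finite (stirling_permutations n)"
  by (simp add: stirling_permutations_def)

lemma length_stirling_permutation: "s \<in> stirling_permutations n \<Longrightarrow> length s = 2 * n"
  by (simp add: stirling_permutations_iff flip: size_mset)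

lemma set_stirling_permutation: "s \<in> stirling_permutations n \<Longrightarrow> set s = {1..n}"
  by (simp add: stirling_permutations_iff flip: set_mset_mset)

section \<open>Insertion of a block and its bijectivity\<close>

lemma subseq_Cons_append_notin:
  "x \<notin> set as \<Longrightarrow> subseq (x # xs) (as @ ys) \<longleftrightarrow> subseq (x # xs) ys"
  by (induction as) auto

text \<open>A gap is numbered by the count of entries to its left, so 0 is the initial gap and
  \<open>length s\<close> the final one.\<close>

definition insert_pair :: "'a \<Rightarrow> 'a list \<Rightarrow> nat \<Rightarrow> 'a list" where
  "insert_pair x s p = take p s @ [x, x] @ drop p s"

lemma filter_insert_pair: "x \<notin> set s \<Longrightarrow> filter (\<lambda>z. z \<noteq> x) (insert_pair x s p) = s"
proof -
  assume "x \<notin> set s"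
  then have "filter (\<lambda>z. z \<noteq> x) (take p s) = take p s" "filter (\<lambda>z. z \<noteq> x) (drop p s) = drop p s"
    by (auto simp: filter_id_conv dest: in_set_takeD in_set_dropD)
  then show ?thesis by (simp add: insert_pair_def)
qed

lemma takeWhile_insert_pair:
  "x \<notin> set s \<Longrightarrow> takeWhile (\<lambda>z. z \<noteq> x) (insert_pair x s p) = take p s"
  unfolding insert_pair_def by (subst takeWhile_append2) (auto dest: in_set_takeD)

text \<open>Deleting all copies of \<open>x\<close> recovers \<open>s\<close>, and the prefix before
  the first \<open>x\<close> has length \<open>p\<close>.\<close>

lemma inj_on_insert_pair:
  assumes "\<And>s. s \<in> S \<Longrightarrow> x \<notin> set s \<and> length s = m"
  shows "inj_on (\<lambda>(s, p). insert_pair x s p) (S \<times> {..m})"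
proof (rule inj_onI, clarsimp)
  fix s p t q
  assume st: "s \<in> S" "t \<in> S" and pq: "p \<le> m" "q \<le> m"
    and eq: "insert_pair x s p = insert_pair x t q"
  have "s = t" using filter_insert_pair[of x] assms st eq by metis
  moreover have "take p s = take q t" using takeWhile_insert_pair[of x] assms st eq by metis
  then have "length (take p s) = length (take q t)" by simp
  then have "p = q" using pq assms st by simp
  ultimately show "s = t \<and> p = q" ..
qed

lemma mset_pairs_Suc:
  "mset_set {1..Suc n} + mset_set {1..Suc n}
     = {#Suc n, Suc n#} + (mset_set {1..n} + mset_set {1..n})"
  by (simp add: atLeastAtMostSuc_conv)

lemma mset_insert_pair: "mset (insert_pair x s p) = {#x, x#} + mset s"
proof -
  have "mset (take p s) + mset (drop p s) = mset s"
    by (metis append_take_drop_id mset_append)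
  then show ?thesis by (simp add: insert_pair_def)
qed

text \<open>In a pattern \<open>[i, j, i]\<close>, \<open>i\<close> cannot be the new maximum, whose
  two copies are adjacent; if \<open>j\<close> is the maximum, \<open>i < j\<close> is clear;
  otherwise the pattern survives deletion of the block and already occurs in
  \<open>s\<close>.\<close>

lemma insert_pair_stirling:
  assumes "s \<in> stirling_permutations n"
  shows "insert_pair (Suc n) s p \<in> stirling_permutations (Suc n)"
proof -
  have notin: "Suc n \<notin> set s" using set_stirling_permutation[OF assms] by simp
  have "i < j" if sub: "subseq [i, j, i] (insert_pair (Suc n) s p)" for i j
  proof -
    have "set (insert_pair (Suc n) s p) = insert (Suc n) {1..n}"
      using set_stirling_permutation[OF assms]
      by (simp add: mset_insert_pair flip: set_mset_mset)
    moreover have "i \<in> set (insert_pair (Suc n) s p)" "j \<in> set (insert_pair (Suc n) s p)"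
      using list_emb_set[OF sub, of i] list_emb_set[OF sub, of j] by auto
    ultimately have le: "i \<le> Suc n" "j \<le> Suc n" by auto
    have notin': "Suc n \<notin> set (take p s)" "Suc n \<notin> set (drop p s)"
      using notin by (auto dest: in_set_takeD in_set_dropD)
    have "i \<noteq> Suc n"
    proof
      assume "i = Suc n"
      \<comment> \<open>The first copy in the block matches the leading \<open>i\<close>, and the
        second can at best match \<open>j\<close>, so \<open>drop p s\<close> would have to supply a
        third copy.\<close>
      then have "subseq [j, Suc n] (Suc n # drop p s)"
        using sub notin' by (simp add: insert_pair_def subseq_Cons_append_notin)
      then have "subseq [Suc n] (drop p s)"
        by (auto split: if_splits dest: subseq_Cons')
      then show False using notin' by (simp add: subseq_singleton_left)
    qed
    show ?thesis
    proof (cases "j = Suc n")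
      case True
      then show ?thesis using le \<open>i \<noteq> Suc n\<close> by simp
    next
      case False
      have "subseq (filter (\<lambda>z. z \<noteq> Suc n) [i, j, i])
        (filter (\<lambda>z. z \<noteq> Suc n) (insert_pair (Suc n) s p))"
        using sub by (rule subseq_filter)
      then show ?thesis
        using False \<open>i \<noteq> Suc n\<close> assms
        by (simp add: filter_insert_pair[OF notin] stirling_permutations_iff)
    qed
  qed
  moreover have "mset s = mset_set {1..n} + mset_set {1..n}"
    using assms stirling_permutations_iff by blast
  then have "mset (insert_pair (Suc n) s p) = mset_set {1..Suc n} + mset_set {1..Suc n}"
    by (simp only: mset_insert_pair mset_pairs_Suc)
  ultimately show ?thesis by (simp only: stirling_permutations_iff) blast
qed

text \<open>An entry between the two copies of the maximum would have to exceed it. Hence the copies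
  are adjacent, and removing them leaves a subsequence of \<open>t\<close>, which inherits the
  Stirling condition.\<close>

lemma stirling_permutation_Suc_cases:
  assumes "t \<in> stirling_permutations (Suc n)"
  obtains s p where "s \<in> stirling_permutations n" "p \<le> 2 * n" "t = insert_pair (Suc n) s p"
proof -
  let ?N = "Suc n"
  have mt: "mset t = {#?N, ?N#} + (mset_set {1..n} + mset_set {1..n})"
    and sub: "\<And>i j. subseq [i, j, i] t \<Longrightarrow> i < j"
    using assms unfolding stirling_permutations_iff mset_pairs_Suc by blast+
  have set_t: "set t = {1..?N}" by (rule set_stirling_permutation[OF assms])
  then have "?N \<in> set t" by simp
  then obtain u v where t: "t = u @ ?N # v" and u: "?N \<notin> set u"
    by (meson split_list_first)
  have "count (mset t) ?N = 2" by (simp add: mt)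
  moreover have "count (mset u) ?N = 0" using u by (simp add: count_eq_zero_iff)
  ultimately have cv: "count (mset v) ?N = 1" by (simp add: t)
  then have "?N \<in> set v" by (metis count_eq_zero_iff set_mset_mset zero_neq_one)
  then obtain w z where v: "v = w @ ?N # z" and w: "?N \<notin> set w"
    by (meson split_list_first)
  have "w = []"
  proof (rule ccontr)
    assume "w \<noteq> []"
    then obtain j w' where w': "w = j # w'" by (cases w) auto
    have "subseq [?N, j, ?N] t"
      unfolding t v w' by (auto intro!: list_emb_append2 simp: subseq_singleton_left)
    then have "?N < j" by (rule sub)
    moreover have "j \<in> set t" by (simp add: t v w')
    ultimately show False using set_t by simp
  qed
  then have t': "t = insert_pair ?N (u @ z) (length u)"
    by (simp add: t v insert_pair_def)
  have "mset (u @ z) = mset_set {1..n} + mset_set {1..n}"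
    using mt unfolding t' mset_insert_pair by simp
  moreover have "subseq z (?N # ?N # z)" by (intro list_emb_Cons subseq_order.refl)
  then have "subseq (u @ z) t"
    using list_emb_append_mono[OF subseq_order.refl] by (simp add: t v \<open>w = []\<close>)
  ultimately have st: "u @ z \<in> stirling_permutations n"
    unfolding stirling_permutations_iff using sub subseq_order.trans by blast
  show thesis
    using that[OF st _ t'] length_stirling_permutation[OF st] by simp
qed

lemma bij_betw_insert_pair:
  "bij_betw (\<lambda>(s, p). insert_pair (Suc n) s p)
     (stirling_permutations n \<times> {..2 * n}) (stirling_permutations (Suc n))"
  unfolding bij_betw_def
proof
  show "inj_on (\<lambda>(s, p). insert_pair (Suc n) s p) (stirling_permutations n \<times> {..2 * n})"
    by (rule inj_on_insert_pair) (simp add: set_stirling_permutation length_stirling_permutation)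
  show "(\<lambda>(s, p). insert_pair (Suc n) s p) ` (stirling_permutations n \<times> {..2 * n})
      = stirling_permutations (Suc n)"
  proof (intro equalityI subsetI)
    fix t assume "t \<in> stirling_permutations (Suc n)"
    then obtain s p where "s \<in> stirling_permutations n" "p \<le> 2 * n" "t = insert_pair (Suc n) s p"
      by (rule stirling_permutation_Suc_cases)
    then show "t \<in> (\<lambda>(s, p). insert_pair (Suc n) s p) ` (stirling_permutations n \<times> {..2 * n})"
      by force
  qed (auto intro: insert_pair_stirling)
qed

section \<open>Effect of an insertion on the ascents\<close>

lemma finite_ascents: "finite (ascents s)"
  by (rule finite_subset[of _ "{..<length s}"]) (auto simp: ascents_def)

lemma ascents_Nil [simp]: "ascents [] = {}"
  by (simp add: ascents_def)

lemma ascents_Cons: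
  "ascents (x # s) = (if s \<noteq> [] \<and> x < hd s then {0} else {}) \<union> Suc ` ascents s"
proof (rule set_eqI)
  show "i \<in> ascents (x # s) \<longleftrightarrow>
      i \<in> (if s \<noteq> [] \<and> x < hd s then {0} else {}) \<union> Suc ` ascents s" for i
    by (cases i) (auto simp: ascents_def hd_conv_nth)
qed

lemma card_ascents_Cons:
  "card (ascents (x # s)) = of_bool (s \<noteq> [] \<and> x < hd s) + card (ascents s)"
proof -
  have "card (Suc ` ascents s) = card (ascents s)" by (simp add: card_image)
  then show ?thesis by (simp add: ascents_Cons finite_ascents card_insert_if image_iff)
qed

lemma card_ascents_append:
  "card (ascents (s @ t))
     = card (ascents s) + of_bool (s \<noteq> [] \<and> t \<noteq> [] \<and> last s < hd t) + card (ascents t)"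
  by (induction s) (auto simp: card_ascents_Cons)

text \<open>The shift by \<open>Suc\<close> is due to an ascent at index \<open>i\<close> straddling
  the gap with \<open>i + 1\<close> entries to its left.\<close>

definition neutral_gaps :: "nat list \<Rightarrow> nat set" where
  "neutral_gaps s = insert 0 (Suc ` ascents s)"

lemma card_neutral_gaps: "card (neutral_gaps s) = Suc (card (ascents s))"
  by (simp add: neutral_gaps_def finite_ascents card_insert_if card_image image_iff)

lemma neutral_gaps_subset: "neutral_gaps s \<subseteq> {..length s}"
  by (auto simp: neutral_gaps_def ascents_def)

text \<open>Entering the block creates an ascent unless the gap is initial; within the block and on
  leaving it there is none. An ascent that straddled the gap is destroyed, which cancels the
  gain.\<close>

lemma card_ascents_insert_pair:
  assumes "\<And>z. z \<in> set s \<Longrightarrow> z < N" "p \<le> length s"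
  shows "card (ascents (insert_pair N s p)) = card (ascents s) + of_bool (p \<notin> neutral_gaps s)"
proof -
  have s: "card (ascents s) = card (ascents (take p s))
      + of_bool (take p s \<noteq> [] \<and> drop p s \<noteq> [] \<and> last (take p s) < hd (drop p s))
      + card (ascents (drop p s))"
    using card_ascents_append[of "take p s" "drop p s"] by simp
  have hd: "\<not> N < hd (drop p s)" if "drop p s \<noteq> []"
    using that assms(1) hd_in_set in_set_dropD less_asym by metis
  have last: "last (take p s) < N" if "take p s \<noteq> []"
    using that assms(1) last_in_set in_set_takeD by metis
  have ins: "card (ascents (insert_pair N s p))
      = card (ascents (take p s)) + of_bool (take p s \<noteq> []) + card (ascents (drop p s))"
    using hd last by (auto simp: insert_pair_def card_ascents_append card_ascents_Cons)
  \<comment> \<open>The final gap of a nonempty list has empty \<open>drop p s\<close>: no ascent is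
    lost there, so it is not neutral.\<close>
  have neutral: "p \<in> neutral_gaps s \<longleftrightarrow>
      take p s = [] \<or> drop p s \<noteq> [] \<and> last (take p s) < hd (drop p s)"
  proof (cases p)
    case 0
    then show ?thesis by (simp add: neutral_gaps_def)
  next
    case (Suc q)
    then show ?thesis
      using assms(2)
      by (auto simp: neutral_gaps_def ascents_def image_iff hd_drop_conv_nth take_Suc_conv_app_nth)
  qed
  show ?thesis unfolding ins s neutral by (auto simp: of_bool_def)
qed

text \<open>Each insertion adds at most one ascent, and the first one, into the empty list, adds
  none.\<close>

lemma card_ascents_stirling_le:
  assumes "s \<in> stirling_permutations n"
  shows "card (ascents s) \<le> n - 1"
  using assms
proof (induction n arbitrary: s)
  case 0
  then show ?case using length_stirling_permutation[OF 0] by simp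
next
  case (Suc n)
  obtain t p where t: "t \<in> stirling_permutations n" "p \<le> 2 * n" "s = insert_pair (Suc n) t p"
    using stirling_permutation_Suc_cases[OF Suc.prems] .
  have "card (ascents s) = card (ascents t) + of_bool (p \<notin> neutral_gaps t)"
    unfolding t(3) using t set_stirling_permutation length_stirling_permutation
    by (intro card_ascents_insert_pair) auto
  \<comment> \<open>Since \<open>n - 1\<close> truncates to 0 at \<open>n = 0\<close>, the bound
    does not grow from order 0 to order 1; the only gap there is the initial one.\<close>
  moreover have "p \<in> neutral_gaps t" if "n = 0" using t(2) that by (simp add: neutral_gaps_def)
  ultimately show ?case using Suc.IH[OF t(1)] by (cases "n = 0") (auto simp: of_bool_def)
qed

text \<open>The exponents count gaps: \<open>indet X\<close> marks those that raise the number of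
  ascents, \<open>indet Y\<close> the neutral ones.\<close>

definition stirling_weight :: "nat \<Rightarrow> nat \<Rightarrow> 'a::field_char_0 poly poly" where
  "stirling_weight n k = indet X ^ (2 * n - k) * indet Y ^ (k + 1)"

section \<open>The operator xD on weights\<close>

context
  fixes D :: "'a::field_char_0 poly poly \<Rightarrow> 'a poly poly"
  assumes D: "formal_derivative grammar_xy D"
begin

lemma D_add: "D (u + v) = D u + D v"
  and D_mult: "D (u * v) = D u * v + u * D v"
  using D unfolding formal_derivative_def by blast+

lemma D_X: "D (indet X) = indet X * indet Y"
  and D_Y: "D (indet Y) = indet X * indet Y"
  using D by (simp_all add: formal_derivative_def grammar_xy_def del: indet.simps)

lemma D_0: "D 0 = 0"
  using D_add[of 0 0] by simp

lemma D_1: "D 1 = 0"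
  using D_mult[of 1 1] by simp

lemma D_sum: "D (sum f A) = (\<Sum>i\<in>A. D (f i))"
  by (induction A rule: infinite_finite_induct) (simp_all add: D_0 D_add)

lemma D_X_power: "D (indet X ^ m) = of_nat m * indet X ^ m * indet Y"
  by (induction m) (simp_all add: D_1 D_mult D_X algebra_simps del: indet.simps)

lemma D_Y_power: "D (indet Y ^ m) = of_nat m * indet X * indet Y ^ m"
  by (induction m) (simp_all add: D_1 D_mult D_Y algebra_simps del: indet.simps)

text \<open>By the product rule and the outer \<open>indet X\<close>, differentiating one of the
  \<open>k + 1\<close> factors \<open>indet Y\<close> adds two factors \<open>indet X\<close>;
  differentiating one of the \<open>2 * n - k\<close> factors \<open>indet X\<close> adds one factor
  of each letter.\<close>

lemma xD_stirling_weight: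
  assumes "k \<le> 2 * n"
  shows "indet X * D (stirling_weight n k)
    = of_nat (Suc k) * stirling_weight (Suc n) k
      + of_nat (2 * n - k) * stirling_weight (Suc n) (Suc k)"
proof -
  \<comment> \<open>The variable \<open>m\<close> removes truncated subtraction from the
    exponents.\<close>
  obtain m where "2 * n = k + m" using assms le_Suc_ex by blast
  then have "2 * n - k = m" "2 * Suc n - k = m + 2" "2 * Suc n - Suc k = m + 1" by simp_all
  then show ?thesis
    by (simp add: stirling_weight_def D_mult D_X_power D_Y_power D_Y algebra_simps
        del: indet.simps)
qed

lemma xD_stirling_weight_eq_sum:
  assumes "s \<in> stirling_permutations n"
  shows "indet X * D (stirling_weight n (card (ascents s)))
    = (\<Sum>p\<le>2 * n. stirling_weight (Suc n) (card (ascents (insert_pair (Suc n) s p))))"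
proof -
  let ?k = "card (ascents s)"
  note len = length_stirling_permutation[OF assms]
  have sub: "neutral_gaps s \<subseteq> {..2 * n}" using neutral_gaps_subset[of s] len by simp
  have fin: "finite (neutral_gaps s)" using sub finite_subset by blast
  \<comment> \<open>Of the \<open>2 * n + 1\<close> gaps, \<open>?k + 1\<close> are neutral.\<close>
  have card': "card ({..2 * n} - neutral_gaps s) = 2 * n - ?k"
    using sub fin by (simp add: card_Diff_subset card_neutral_gaps)
  have asc: "card (ascents (insert_pair (Suc n) s p)) = ?k + of_bool (p \<notin> neutral_gaps s)"
    if "p \<le> 2 * n" for p
    using that len set_stirling_permutation[OF assms] by (intro card_ascents_insert_pair) auto
  have "(\<Sum>p\<le>2 * n. stirling_weight (Suc n) (card (ascents (insert_pair (Suc n) s p))))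
    = (\<Sum>p\<le>2 * n. stirling_weight (Suc n) (?k + of_bool (p \<notin> neutral_gaps s)) :: 'a poly poly)"
    by (rule sum.cong) (simp_all add: asc)
  also have "\<dots> = (\<Sum>p\<in>{..2 * n} - neutral_gaps s. stirling_weight (Suc n) (Suc ?k))
      + (\<Sum>p\<in>neutral_gaps s. stirling_weight (Suc n) ?k)"
    by (subst sum.subset_diff[OF sub]) simp_all
  also have "\<dots> = indet X * D (stirling_weight n ?k)"
    using card_ascents_stirling_le[OF assms]
    by (subst xD_stirling_weight) (simp_all add: card' card_neutral_gaps)
  finally show ?thesis ..
qed

lemma xD_power_Y:
  "((\<lambda>u. indet X * D u) ^^ n) (indet Y)
     = (\<Sum>s\<in>stirling_permutations n. stirling_weight n (card (ascents s)))"
proof (induction n)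
  case 0
  have "stirling_permutations 0 = {[]}"
    by (auto simp: stirling_permutations_iff)
  then show ?case by (simp add: stirling_weight_def)
next
  case (Suc n)
  have "((\<lambda>u. indet X * D u) ^^ Suc n) (indet Y)
    = (\<Sum>s\<in>stirling_permutations n. indet X * D (stirling_weight n (card (ascents s))))"
    by (simp add: Suc D_sum sum_distrib_left del: indet.simps)
  also have "\<dots> = (\<Sum>s\<in>stirling_permutations n. \<Sum>p\<le>2 * n.
      stirling_weight (Suc n) (card (ascents (insert_pair (Suc n) s p))))"
    by (intro sum.cong refl xD_stirling_weight_eq_sum)
  \<comment> \<open>Pairs of a permutation and a gap are reindexed by the insertion
    bijection.\<close>
  also have "\<dots> = (\<Sum>t\<in>stirling_permutations (Suc n). stirling_weight (Suc n) (card (ascents t)))"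
    using sum.reindex_bij_betw[OF bij_betw_insert_pair[of n],
        of "\<lambda>t. stirling_weight (Suc n) (card (ascents t))"]
    by (simp add: sum.cartesian_product case_prod_beta)
  finally show ?case .
qed

lemma xD_power_X:
  assumes "n \<ge> 1"
  shows "((\<lambda>u. indet X * D u) ^^ n) (indet X) = ((\<lambda>u. indet X * D u) ^^ n) (indet Y)"
proof -
  obtain m where "n = Suc m" using assms by (cases n) auto
  \<comment> \<open>Once the innermost application is split off, both letters have the same image
    under it.\<close>
  then show ?thesis by (simp only: funpow_Suc_right o_apply D_X D_Y)
qed

end

theorem theorem5:
  fixes D :: "'a::field_char_0 poly poly \<Rightarrow> 'a poly poly" and n :: nat
  assumes "formal_derivative grammar_xy D"
    and "n \<ge> 1"
  shows "((\<lambda>u. indet X * D u) ^^ n) (indet X)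
       = (\<Sum>k=0..n-1. of_nat (eulerian2 n k) * indet X ^ (2 * n - k) * indet Y ^ (k + 1))"
proof -
  have "((\<lambda>u. indet X * D u) ^^ n) (indet X)
    = (\<Sum>s\<in>stirling_permutations n. stirling_weight n (card (ascents s)))"
    using xD_power_X[OF assms] xD_power_Y[OF assms(1)] by (rule trans)
  \<comment> \<open>The bound \<open>n - 1\<close> on ascents ensures that these fibres cover all
    permutations; the weight is constant on each fibre, whose size is
    \<open>eulerian2 n k\<close>.\<close>
  also have "\<dots> = (\<Sum>k=0..n-1. \<Sum>s\<in>{s \<in> stirling_permutations n. card (ascents s) = k}.
      stirling_weight n (card (ascents s)))"
    by (rule sum.group[symmetric])
      (use card_ascents_stirling_le in \<open>auto simp: finite_stirling_permutations\<close>)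
  also have "\<dots> = (\<Sum>k=0..n-1. of_nat (eulerian2 n k) * stirling_weight n k)"
    by (simp add: eulerian2_def)
  finally show ?thesis by (simp add: stirling_weight_def mult.assoc del: indet.simps)
qed

end
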